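(* Let $R,S,S'$ be rings and let $(\mathfrak a,M),(\mathfrak a',M')$ be the elements of $\operatorname{Hom}(R)$ corresponding to two ring morphisms $\varphi\colon R\to S$ and $\varphi'\colon R\to S'$. Then the element of $\operatorname{Hom}(R)$ corresponding to the product morphism $\varphi\times\varphi'\colon R\to S\times S'$, $r\mapsto(\varphi(r),\varphi'(r))$, is $(\mathfrak a\cap\mathfrak a',M\cap M')$.
   Context: All rings are associative with identity $1\neq 0$ and ring morphisms send $1$ to $1$. $U(S)$ denotes the group of two-sided invertible elements of a ring $S$. The pair corresponding to a ring morphism $\varphi\colon R\to S$ is $(\ker(\varphi),\varphi^{-1}(U(S)))$, and $\operatorname{Hom}(R)$ denotes the set of all such pairs, with $S$ ranging over all rings, partially ordered by $(\mathfrak a,M)\le(\mathfrak b,N)$ if and only if $\mathfrak a\subseteq\mathfrak b$ and $M\subseteq N$. *)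

theory Defs
  imports "HOL-Algebra.Algebra"
begin

text \<open>HOL-Algebra's \<^locale>\<open>ring\<close> is associative and unital but admits the zero ring.\<close>

locale nontrivial_ring = ring +
  assumes one_not_zero: "\<one> \<noteq> \<zero>"

definition hom_pair ::
    "('a, 'm) ring_scheme \<Rightarrow> ('b, 'n) ring_scheme \<Rightarrow> ('a \<Rightarrow> 'b) \<Rightarrow> 'a set \<times> 'a set" where
  "hom_pair R S \<phi> = (a_kernel R S \<phi>, {r \<in> carrier R. \<phi> r \<in> Units S})"

text \<open>
  A definition cannot quantify over the element type of \<open>S\<close>, so below \<open>S\<close> ranges over the
  rings whose elements are taken from the element type of \<open>R\<close>. Nothing is lost: the pair of a
  morphism into a ring over any other type already arises in this way, as lemma
  \<open>hom_pair_in_Hom\<close> shows. Indeed the subring of \<open>S\<close> generated by the image of \<open>R\<close>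
  and the inverses of the units in that image gives the same pair, and it is no larger
  than \<open>R\<close> if \<open>R\<close> is infinite; if \<open>R\<close> is finite, the image of \<open>R\<close> suffices.
\<close>

definition Hom :: "('a, 'm) ring_scheme \<Rightarrow> ('a set \<times> 'a set) set" where
  "Hom R = {hom_pair R S \<phi> | (S :: 'a ring) \<phi>. nontrivial_ring S \<and> \<phi> \<in> ring_hom R S}"

lemma hom_pair_in_Hom_if_subring:
  fixes R :: "('a, 'm) ring_scheme" and S :: "('b, 'n) ring_scheme"
  assumes R: "nontrivial_ring R" and S: "nontrivial_ring S" and \<phi>: "\<phi> \<in> ring_hom R S"
    and T: "subring T S" "\<phi> ` carrier R \<subseteq> T"
    and inv_T: "\<And>r. \<lbrakk>r \<in> carrier R; \<phi> r \<in> Units S\<rbrakk> \<Longrightarrow> inv\<^bsub>S\<^esub> (\<phi> r) \<in> T"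
    and f: "inj_on f T" "f ` T \<subseteq> carrier R"
  shows "hom_pair R S \<phi> \<in> Hom R"
proof -
  interpret S: nontrivial_ring S by fact
  interpret R: nontrivial_ring R by fact
  let ?T = "S\<lparr>carrier := T\<rparr>"
  interpret T: ring ?T by (rule S.subring_is_ring[OF T(1)])
  have TS: "T \<subseteq> carrier S" using subringE(1)[OF T(1)] .
  have zT: "\<zero>\<^bsub>S\<^esub> \<in> T" and oT: "\<one>\<^bsub>S\<^esub> \<in> T"
    using subringE(2,3)[OF T(1)] by auto
  define Q where "Q = image_ring f ?T"
  have inj: "inj_on f (carrier ?T)" using f by simp
  interpret Q: ring Q unfolding Q_def by (rule T.inj_imp_image_ring_is_ring[OF inj])
  have iso: "f \<in> ring_iso ?T Q" unfolding Q_def by (rule inj_imp_image_ring_iso[OF inj])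
  then have fh: "f \<in> ring_hom ?T Q" by (simp add: ring_iso_def)
  have carQ: "carrier Q = f ` T" by (simp add: Q_def image_ring_carrier)
  have f1: "f \<one>\<^bsub>S\<^esub> = \<one>\<^bsub>Q\<^esub>" and f0: "f \<zero>\<^bsub>S\<^esub> = \<zero>\<^bsub>Q\<^esub>"
    by (simp_all add: Q_def image_ring_one image_ring_zero)
  have fm: "f (x \<otimes>\<^bsub>S\<^esub> y) = f x \<otimes>\<^bsub>Q\<^esub> f y" if "x \<in> T" "y \<in> T" for x y
    using ring_hom_mult[OF fh] that by simp
  have ntQ: "nontrivial_ring Q"
  proof unfold_locales
    show "\<one>\<^bsub>Q\<^esub> \<noteq> \<zero>\<^bsub>Q\<^esub>"
      using f(1) S.one_not_zero zT oT unfolding f1[symmetric] f0[symmetric]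
      by (simp add: inj_on_eq_iff)
  qed
  have \<phi>T: "\<phi> \<in> ring_hom R ?T"
    using \<phi> T(2) by (auto simp: ring_hom_def)
  have hom: "f \<circ> \<phi> \<in> ring_hom R Q" by (rule ring_hom_trans[OF \<phi>T fh])
  have ker: "a_kernel R Q (f \<circ> \<phi>) = a_kernel R S \<phi>"
    unfolding a_kernel_def' using f(1) zT T(2)
    by (auto simp: f0[symmetric] inj_on_eq_iff image_subset_iff)
  have un: "f (\<phi> r) \<in> Units Q \<longleftrightarrow> \<phi> r \<in> Units S" if r: "r \<in> carrier R" for r
  proof
    assume u: "\<phi> r \<in> Units S"
    have rT: "\<phi> r \<in> T" using T(2) r by auto
    have iT: "inv\<^bsub>S\<^esub> (\<phi> r) \<in> T" by (rule inv_T[OF r u])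
    have "f (\<phi> r) \<otimes>\<^bsub>Q\<^esub> f (inv\<^bsub>S\<^esub> (\<phi> r)) = \<one>\<^bsub>Q\<^esub>" "f (inv\<^bsub>S\<^esub> (\<phi> r)) \<otimes>\<^bsub>Q\<^esub> f (\<phi> r) = \<one>\<^bsub>Q\<^esub>"
      using u by (simp_all add: fm[OF rT iT, symmetric] fm[OF iT rT, symmetric] f1)
    then show "f (\<phi> r) \<in> Units Q"
      using rT iT unfolding Units_def carQ by blast
  next
    assume "f (\<phi> r) \<in> Units Q"
    then obtain y where y: "y \<in> T" "f y \<otimes>\<^bsub>Q\<^esub> f (\<phi> r) = \<one>\<^bsub>Q\<^esub>" "f (\<phi> r) \<otimes>\<^bsub>Q\<^esub> f y = \<one>\<^bsub>Q\<^esub>"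
      unfolding Units_def carQ by auto
    have rT: "\<phi> r \<in> T" using T(2) r by auto
    have "f (y \<otimes>\<^bsub>S\<^esub> \<phi> r) = f \<one>\<^bsub>S\<^esub>" "f (\<phi> r \<otimes>\<^bsub>S\<^esub> y) = f \<one>\<^bsub>S\<^esub>"
      using y rT by (simp_all add: fm f1)
    then have "y \<otimes>\<^bsub>S\<^esub> \<phi> r = \<one>\<^bsub>S\<^esub>" "\<phi> r \<otimes>\<^bsub>S\<^esub> y = \<one>\<^bsub>S\<^esub>"
      using f(1) oT y(1) rT subringE(6)[OF T(1)] by (auto simp: inj_on_eq_iff)
    then show "\<phi> r \<in> Units S"
      using y(1) rT TS unfolding Units_def by blast
  qed
  have "hom_pair R S \<phi> = hom_pair R Q (f \<circ> \<phi>)"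
    unfolding hom_pair_def ker using un by auto
  then show ?thesis
    unfolding Hom_def using ntQ hom by blast
qed

lemma card_of_generate_ring:
  fixes S :: "('b, 'n) ring_scheme" and A :: "'a set"
  assumes inf: "infinite A" and H: "|H| \<le>o |A|"
  shows "|generate_ring S H| \<le>o |A|"
proof -
  define F where "F B = B \<union> (\<lambda>x. \<ominus>\<^bsub>S\<^esub> x) ` B
      \<union> (\<lambda>(x, y). x \<oplus>\<^bsub>S\<^esub> y) ` (B \<times> B) \<union> (\<lambda>(x, y). x \<otimes>\<^bsub>S\<^esub> y) ` (B \<times> B)" for B
  define G where "G n = (F ^^ n) (insert \<one>\<^bsub>S\<^esub> H)" for n
  note Un = card_of_Un_ordLeq_infinite_Field[of "|A|", simplified, OF inf]
  have im: "|g ` B| \<le>o |A|" if "|B| \<le>o |A|" for g :: "'x \<Rightarrow> 'b" and B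
    using ordLeq_transitive[OF card_of_image that] .
  have times: "|B \<times> B| \<le>o |A|" if "|B| \<le>o |A|" for B :: "'b set"
    using card_of_Sigma_ordLeq_infinite[OF inf that, of "\<lambda>_. B"] that by simp
  have G_card: "|G n| \<le>o |A|" for n
  proof (induction n)
    case 0
    have "|{\<one>\<^bsub>S\<^esub>}| \<le>o |A|"
      using card_of_singl_ordLeq[of A "\<one>\<^bsub>S\<^esub>"] infinite_imp_nonempty[OF inf] by blast
    then show ?case using Un[OF _ H, of "{\<one>\<^bsub>S\<^esub>}"] by (simp add: G_def)
  next
    case (Suc n)
    have "G (Suc n) = F (G n)" by (simp add: G_def)
    then show ?case using Suc by (auto simp: F_def intro!: Un im times)
  qed
  have nat: "|UNIV :: nat set| \<le>o |A|"
    using inf infinite_iff_card_of_nat by blast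
  have UG: "|\<Union>n. G n| \<le>o |A|"
    using card_of_UNION_ordLeq_infinite[OF inf nat] G_card by blast
  have step: "F (G n) = G (Suc n)" for n by (simp add: G_def)
  have mono: "G m \<subseteq> G n" if "m \<le> n" for m n
    using that by (rule lift_Suc_mono_le[rotated]) (auto simp: step[symmetric] F_def)
  have "x \<in> (\<Union>n. G n)" if "x \<in> generate_ring S H" for x
    using that
  proof induction
    case one
    have "\<one>\<^bsub>S\<^esub> \<in> G 0" by (simp add: G_def)
    then show ?case by blast
  next
    case (incl h)
    then have "h \<in> G 0" by (simp add: G_def)
    then show ?case by blast
  next
    case (a_inv h)
    then obtain n where "h \<in> G n" by auto
    then have "\<ominus>\<^bsub>S\<^esub> h \<in> G (Suc n)" by (auto simp: step[symmetric] F_def)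
    then show ?case by blast
  next
    case (eng_add x y)
    then obtain m n where "x \<in> G m" "y \<in> G n" by auto
    then have "x \<in> G (max m n)" "y \<in> G (max m n)"
      using mono[of m "max m n"] mono[of n "max m n"] by auto
    then have "x \<oplus>\<^bsub>S\<^esub> y \<in> G (Suc (max m n))"
      unfolding step[symmetric] F_def by force
    then show ?case by blast
  next
    case (eng_mult x y)
    then obtain m n where "x \<in> G m" "y \<in> G n" by auto
    then have "x \<in> G (max m n)" "y \<in> G (max m n)"
      using mono[of m "max m n"] mono[of n "max m n"] by auto
    then have "x \<otimes>\<^bsub>S\<^esub> y \<in> G (Suc (max m n))"
      unfolding step[symmetric] F_def by force
    then show ?case by blast
  qed
  then have "generate_ring S H \<subseteq> (\<Union>n. G n)" by blast
  from ordLeq_transitive[OF card_of_mono1[OF this] UG] show ?thesis .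
qed

lemma hom_pair_in_Hom:
  fixes R :: "('a, 'm) ring_scheme" and S :: "('b, 'n) ring_scheme"
  assumes R: "nontrivial_ring R" and S: "nontrivial_ring S" and \<phi>: "\<phi> \<in> ring_hom R S"
  shows "hom_pair R S \<phi> \<in> Hom R"
proof -
  interpret S: nontrivial_ring S by fact
  interpret R: nontrivial_ring R by fact
  interpret \<phi>: ring_hom_ring R S \<phi>
    by (rule ring_hom_ringI2[OF R.ring_axioms S.ring_axioms \<phi>])
  let ?I = "\<phi> ` carrier R"
  have IS: "?I \<subseteq> carrier S" by auto
  show ?thesis
  proof (cases "finite (carrier R)")
    case True
    have sub: "subring ?I S" by (rule \<phi>.img_is_subring[OF R.carrier_is_subring])
    have "inv\<^bsub>S\<^esub> (\<phi> r) \<in> ?I" if r: "r \<in> carrier R" "\<phi> r \<in> Units S" for r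
    proof -
      have "inj_on (\<lambda>x. \<phi> r \<otimes>\<^bsub>S\<^esub> x) ?I"
        using r IS by (auto simp: inj_on_def)
      moreover have "(\<lambda>x. \<phi> r \<otimes>\<^bsub>S\<^esub> x) ` ?I \<subseteq> ?I"
        using r subringE(6)[OF sub] by blast
      ultimately have "(\<lambda>x. \<phi> r \<otimes>\<^bsub>S\<^esub> x) ` ?I = ?I"
        using True by (intro endo_inj_surj) auto
      moreover have "\<one>\<^bsub>S\<^esub> \<in> ?I" using subringE(3)[OF sub] .
      ultimately obtain x where x: "x \<in> ?I" "\<phi> r \<otimes>\<^bsub>S\<^esub> x = \<one>\<^bsub>S\<^esub>" by (metis imageE)
      have xS: "x \<in> carrier S" using x(1) IS by blast
      have "inv\<^bsub>S\<^esub> (\<phi> r) = inv\<^bsub>S\<^esub> (\<phi> r) \<otimes>\<^bsub>S\<^esub> (\<phi> r \<otimes>\<^bsub>S\<^esub> x)"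
        using x r by simp
      also have "\<dots> = x"
        using r xS by (simp add: S.m_assoc[symmetric])
      finally show ?thesis using x(1) by simp
    qed
    moreover have "inj_on (inv_into (carrier R) \<phi>) ?I" by (rule inj_on_inv_into) simp
    moreover have "inv_into (carrier R) \<phi> ` ?I \<subseteq> carrier R" by (auto intro: inv_into_into)
    ultimately show ?thesis
      using hom_pair_in_Hom_if_subring[OF R S \<phi> sub] by blast
  next
    case False
    define J where "J = (\<lambda>r. inv\<^bsub>S\<^esub> (\<phi> r)) ` {r \<in> carrier R. \<phi> r \<in> Units S}"
    let ?T = "generate_ring S (?I \<union> J)"
    have "J \<subseteq> carrier S" by (auto simp: J_def)
    then have sub: "subring ?T S" using IS by (intro S.generate_ring_is_subring) auto
    have "|J| \<le>o |carrier R|"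
      unfolding J_def by (rule ordLeq_transitive[OF card_of_image card_of_mono1]) auto
    then have "|?I \<union> J| \<le>o |carrier R|"
      using card_of_Un_ordLeq_infinite_Field[of "|carrier R|", simplified, OF False card_of_image]
      by simp
    then have "|?T| \<le>o |carrier R|" by (rule card_of_generate_ring[OF False])
    then obtain f where "inj_on f ?T" "f ` ?T \<subseteq> carrier R"
      unfolding card_of_ordLeq[symmetric] by blast
    moreover have "?I \<subseteq> ?T" by (auto intro: generate_ring.incl)
    moreover have "inv\<^bsub>S\<^esub> (\<phi> r) \<in> ?T" if "r \<in> carrier R" "\<phi> r \<in> Units S" for r
      using that by (auto simp: J_def intro: generate_ring.incl)
    ultimately show ?thesis
      using hom_pair_in_Hom_if_subring[OF R S \<phi> sub] by blast
  qed
qed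

end

theory Submission
  imports Defs
begin

text \<open>
  The operations of a product ring are componentwise, so \<open>(\<phi> r, \<phi>' r)\<close> is zero exactly when
  both components are zero, and invertible exactly when both components are invertible: a
  two-sided inverse of a pair is the same thing as a pair of two-sided inverses. These
  equivalences, \<open>a_kernel_RDirProd\<close> and \<open>Units_RDirProd\<close>, turn the kernel and the unit preimage of
  the product morphism into intersections.

  The product ring has elements of type \<open>'b \<times> 'c\<close>, while \<open>Hom R\<close> is defined through rings over
  the element type of \<open>R\<close>. The pair of the product morphism still lies in \<open>Hom R\<close> because
  \<open>hom_pair_in_Hom\<close> replaces the codomain by a ring over that type without changing the pair.
\<close>

lemma Units_RDirProd: "Units (RDirProd S S') = Units S \<times> Units S'"
  by (fastforce simp: Units_def RDirProd_def DirProd_def monoid.defs)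

lemma a_kernel_RDirProd:
  "a_kernel R (RDirProd S S') (\<lambda>r. (f r, g r)) = a_kernel R S f \<inter> a_kernel R S' g"
  by (auto simp: a_kernel_def' RDirProd_def DirProd_def monoid.defs)

lemma hom_pair_RDirProd:
  "hom_pair R (RDirProd S S') (\<lambda>r. (f r, g r)) =
    (fst (hom_pair R S f) \<inter> fst (hom_pair R S' g), snd (hom_pair R S f) \<inter> snd (hom_pair R S' g))"
  by (auto simp: hom_pair_def a_kernel_RDirProd Units_RDirProd)

lemma nontrivial_ring_RDirProd:
  assumes "nontrivial_ring S" and "ring S'"
  shows "nontrivial_ring (RDirProd S S')"
proof -
  interpret S: nontrivial_ring S by fact
  show ?thesis
    using RDirProd_ring[OF S.ring_axioms assms(2)] S.one_not_zero
    by (simp add: nontrivial_ring_def nontrivial_ring_axioms_def RDirProd_def DirProd_def monoid.defs)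
qed

lemma ring_hom_RDirProd:
  assumes "f \<in> ring_hom R S" and "g \<in> ring_hom R S'"
  shows "(\<lambda>r. (f r, g r)) \<in> ring_hom R (RDirProd S S')"
  using assms by (auto simp: ring_hom_def RDirProd_def DirProd_def monoid.defs)

theorem lemma2p6:
  fixes R :: "('a, 'm) ring_scheme"
    and S :: "('b, 'n) ring_scheme"
    and S' :: "('c, 'k) ring_scheme"
    and \<phi> :: "'a \<Rightarrow> 'b" and \<phi>' :: "'a \<Rightarrow> 'c"
    and \<aa> M \<aa>' M' :: "'a set"
  assumes "nontrivial_ring R" and "nontrivial_ring S" and "nontrivial_ring S'"
    and "\<phi> \<in> ring_hom R S" and "\<phi>' \<in> ring_hom R S'"
    and "(\<aa>, M) = hom_pair R S \<phi>" and "(\<aa>', M') = hom_pair R S' \<phi>'"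
  shows "nontrivial_ring (RDirProd S S')
    \<and> (\<lambda>r. (\<phi> r, \<phi>' r)) \<in> ring_hom R (RDirProd S S')
    \<and> (\<aa> \<inter> \<aa>', M \<inter> M') \<in> Hom R
    \<and> hom_pair R (RDirProd S S') (\<lambda>r. (\<phi> r, \<phi>' r)) = (\<aa> \<inter> \<aa>', M \<inter> M')"
proof -
  have ring': "ring S'"
    using assms(3) by (rule nontrivial_ring.axioms)
  have nontrivial: "nontrivial_ring (RDirProd S S')"
    by (rule nontrivial_ring_RDirProd[OF assms(2) ring'])
  have hom: "(\<lambda>r. (\<phi> r, \<phi>' r)) \<in> ring_hom R (RDirProd S S')"
    using assms(4,5) by (rule ring_hom_RDirProd)
  have pair: "hom_pair R (RDirProd S S') (\<lambda>r. (\<phi> r, \<phi>' r)) = (\<aa> \<inter> \<aa>', M \<inter> M')"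
    by (simp add: hom_pair_RDirProd flip: assms(6,7))
  show ?thesis
    using nontrivial hom pair hom_pair_in_Hom[OF assms(1) nontrivial hom] by simp
qed

end
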